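(* Let $n\in\mathbb{N}$, $1<p<\infty$, $\alpha>np-1$, and let $C$ be any convex curve in $\mathbb{D}$. Then for every $f\in Q_h(n,p,\alpha)$, $$\int_C|f(z)|^p(1-|z|^2)^{\alpha+1-np}\,|dz|\le K_{p,\alpha,C}\int_{\mathbb{D}}|f(z)|^p(1-|z|^2)^{\alpha-np}\,dA(z),$$ where $K_{p,\alpha,C}$ is a positive constant depending only on $p$, $\alpha$ and $C$.
   Context: $\mathbb{D}=\{z\in\mathbb{C}:|z|<1\}$, $\mathbb{N}=\{1,2,3,\dots\}$. $dA(z)=\frac{1}{\pi}\,dx\,dy$ is normalized area measure on $\mathbb{D}$. For $a\in\mathbb{D}$, $\sigma_a(z)=\frac{a-z}{1-\overline{a}z}$. For $0<p<\infty$, $\alpha>-1$, $n\in\mathbb{N}$, $Q_h(n,p,\alpha)$ is the set of complex-valued harmonic functions $f=h+\overline{g}$ on $\mathbb{D}$ ($h,g$ analytic) with $\sup_{a\in\mathbb{D}}\int_{\mathbb{D}}\left(|(h\circ\sigma_a)^{(n)}(z)|+|(g\circ\sigma_a)^{(n)}(z)|\right)^p(1-|z|^2)^\alpha\,dA(z)<\infty$. A convex curve in $\mathbb{D}$ is a simple closed curve contained in $\mathbb{D}$ that bounds a convex region (in particular it is a compact subset of $\mathbb{D}$). $|dz|$ is arc length. *)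

theory Defs
  imports "HOL-Analysis.Analysis"
begin

abbreviation unit_disc :: "complex set" where
  "unit_disc \<equiv> ball 0 1"

definition dA :: "complex measure" where
  "dA = scale_measure (ennreal (1 / pi)) lborel"

definition disc_aut :: "complex \<Rightarrow> complex \<Rightarrow> complex" where
  "disc_aut a z = (a - z) / (1 - cnj a * z)"

(* Elements of Qh are total functions, but only their values on the disc matter.
   The decomposition f = h + cnj g is unique up to additive constants; since n \<ge> 1 in all
   uses, the supremum does not depend on the choice of h and g. *)
definition Qh :: "nat \<Rightarrow> real \<Rightarrow> real \<Rightarrow> (complex \<Rightarrow> complex) set" where
  "Qh n p \<alpha> = {f. \<exists>h g. h holomorphic_on unit_disc \<and> g holomorphic_on unit_disc \<and>
     (\<forall>z\<in>unit_disc. f z = h z + cnj (g z)) \<and>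
     (SUP a\<in>unit_disc. \<integral>\<^sup>+z\<in>unit_disc.
        ennreal ((norm ((deriv ^^ n) (h \<circ> disc_aut a) z)
                  + norm ((deriv ^^ n) (g \<circ> disc_aut a) z)) powr p
                 * (1 - (norm z)\<^sup>2) powr \<alpha>) \<partial>dA) < \<infinity>}"

(* Length of \<gamma> on [a,b], for a \<le> b: supremum of the lengths of inscribed polygons. *)
definition arc_length :: "(real \<Rightarrow> complex) \<Rightarrow> real \<Rightarrow> real \<Rightarrow> ennreal" where
  "arc_length \<gamma> a b =
     (SUP (m, t) \<in> {(m :: nat, t :: nat \<Rightarrow> real).
                     t 0 = a \<and> t m = b \<and> (\<forall>i<m. t i \<le> t (Suc i))}.
        \<Sum>i<m. ennreal (dist (\<gamma> (t i)) (\<gamma> (t (Suc i)))))"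

(* Integral of F \<ge> 0 along \<gamma> : [0,1] \<rightarrow> \<complex> with respect to arc length: the Lebesgue-Stieltjes
   integral of F o \<gamma> against the length s(t) of \<gamma> on [0,t], extended constantly outside [0,1].
   For a continuous \<gamma> of finite length s is continuous and nondecreasing.
   Along a curve of infinite length the integral is set to \<infinity>, so a finite upper bound for the
   integral includes the assertion that the curve is rectifiable. *)
definition arc_length_integral :: "(real \<Rightarrow> complex) \<Rightarrow> (complex \<Rightarrow> ennreal) \<Rightarrow> ennreal" where
  "arc_length_integral \<gamma> F =
     (if arc_length \<gamma> 0 1 < \<infinity>
      then \<integral>\<^sup>+t\<in>{0..1}. F (\<gamma> t)
             \<partial>interval_measure (\<lambda>t. enn2real (arc_length \<gamma> 0 (max 0 (min 1 t))))
      else \<infinity>)"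

definition simple_closed_param :: "(real \<Rightarrow> complex) \<Rightarrow> complex set \<Rightarrow> bool" where
  "simple_closed_param \<gamma> C \<longleftrightarrow>
     simple_path \<gamma> \<and> pathfinish \<gamma> = pathstart \<gamma> \<and> path_image \<gamma> = C"

(* inside C is the union of the bounded components of the complement of C. *)
definition convex_curve_in_disc :: "complex set \<Rightarrow> bool" where
  "convex_curve_in_disc C \<longleftrightarrow>
     (\<exists>\<gamma>. simple_closed_param \<gamma> C) \<and> C \<subseteq> unit_disc \<and> convex (inside C)"

end

theory Submission
  imports Defs "HOL-Complex_Analysis.Cauchy_Integral_Formula"
begin

text \<open>
  Let \<open>f\<close> be harmonic on the disc. Its area mean value property makes \<open>|f| powr p\<close> subharmonic, and on
  discs of a fixed radius centred on the compact curve \<open>C\<close> the weights are bounded above and below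
  uniformly in \<open>n\<close>. Hence \<open>|f| powr p\<close> is bounded on \<open>C\<close> by a multiple of the weighted area integral,
  and it remains to bound the length of \<open>C\<close>. Seen from an interior point, \<open>C\<close> is a Lipschitz
  function of the angle, and the angle is monotone along any simple closed parametrization and
  makes at most one full turn.
\<close>

section \<open>Mass of intervals under a Lebesgue-Stieltjes measure\<close>

text \<open>If \<open>F\<close> is not right-continuous or not monotone, there may be no measure with the prescribed
  values; \<^const>\<open>interval_measure\<close> is then the zero measure.\<close>
lemma emeasure_interval_measure_Ioc_le:
  assumes "a \<le> b"
  shows "emeasure (interval_measure F) {a<..b} \<le> ennreal (F b - F a)"
proof -
  define I where "I = {(a, b). a \<le> (b :: real)}"
  define G where "G = (\<lambda>(a, b). {a<..b :: real})"
  define \<mu> where "\<mu> = (\<lambda>(a, b). ennreal (F b - F a))"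
  define M where "M = interval_measure F"
  have M: "M = extend_measure UNIV I G \<mu>"
    by (simp add: M_def interval_measure_def I_def G_def \<mu>_def)
  have ab: "(a, b) \<in> I"
    using assms by (simp add: I_def)
  have sets_M: "sets M = sigma_sets UNIV (G ` I)"
    by (simp add: M sets_extend_measure)
  have G_sets: "G i \<in> sets M" if "i \<in> I" for i
    using that by (auto simp: sets_M)
  have "emeasure M (G (a, b)) \<le> \<mu> (a, b)"
  proof (cases "\<exists>\<mu>'. (\<forall>i\<in>I. \<mu>' (G i) = \<mu> i) \<and> measure_space UNIV (sigma_sets UNIV (G ` I)) \<mu>'")
    case True
    then obtain \<mu>' where \<mu>': "\<And>i. i \<in> I \<Longrightarrow> \<mu>' (G i) = \<mu> i"
        "measure_space UNIV (sigma_sets UNIV (G ` I)) \<mu>'"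
      by auto
    have "emeasure M (G (a, b)) = \<mu> (a, b)"
      by (rule emeasure_extend_measure[OF M \<mu>'(1)])
         (use \<mu>'(2) ab in \<open>auto simp: sets_M measure_space_def\<close>)
    then show ?thesis by simp
  next
    case False
    then have "M = measure_of UNIV (G ` I) (\<lambda>_. 0)"
      unfolding M extend_measure_def by auto
    then have "emeasure M (G (a, b)) = 0"
      by (rule emeasure_measure_of)
         (use G_sets[OF ab] in \<open>auto simp: positive_def countably_additive_def\<close>)
    then show ?thesis by simp
  qed
  then show ?thesis
    by (simp add: M_def G_def \<mu>_def)
qed

section \<open>Lebesgue measure on the plane: Fubini, shears and rotations\<close>

text \<open>Lebesgue measure is determined by its values on open boxes, and the preimage of a box is
  a product of two open intervals. This opens the way to Fubini in real and imaginary parts.\<close>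

lemma lborel_complex: "lborel = distr (lborel \<Otimes>\<^sub>M lborel) borel (\<lambda>(x, y). Complex x y)"
proof (rule lborel_eqI)
  have [measurable]: "(\<lambda>(x, y). Complex x y) \<in> borel_measurable (lborel \<Otimes>\<^sub>M lborel)"
    by (simp add: Complex_eq split_beta')
  fix l u :: complex
  assume "\<And>b. b \<in> Basis \<Longrightarrow> l \<bullet> b \<le> u \<bullet> b"
  from this[of 1] this[of \<i>] have le: "Re l \<le> Re u" "Im l \<le> Im u"
    by (simp_all add: Basis_complex_def)
  have "(\<lambda>(x, y). Complex x y) -` box l u \<inter> space (lborel \<Otimes>\<^sub>M lborel)
      = {Re l<..<Re u} \<times> {Im l<..<Im u}"
    by (auto simp: box_complex_eq space_pair_measure in_box_complex_iff)
  then have "emeasure (distr (lborel \<Otimes>\<^sub>M lborel) borel (\<lambda>(x, y). Complex x y)) (box l u)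
      = emeasure (lborel \<Otimes>\<^sub>M lborel) ({Re l<..<Re u} \<times> {Im l<..<Im u})"
    by (simp add: emeasure_distr)
  also have "\<dots> = ennreal ((Re u - Re l) * (Im u - Im l))"
    using le by (simp add: lborel.emeasure_pair_measure_Times ennreal_mult)
  finally show "emeasure (distr (lborel \<Otimes>\<^sub>M lborel) borel (\<lambda>(x, y). Complex x y)) (box l u)
      = (\<Prod>b\<in>Basis. (u - l) \<bullet> b)"
    by (simp add: Basis_complex_def)
qed simp

lemma measurable_Complex [measurable (raw)]:
  assumes [measurable]: "f \<in> borel_measurable M" "g \<in> borel_measurable M"
  shows "(\<lambda>x. Complex (f x) (g x)) \<in> borel_measurable M"
  by (simp add: Complex_eq)

text \<open>Both orders of integration are recorded because each of the two shears below needs the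
  coordinate that it moves to be the inner one.\<close>

lemma nn_integral_lborel_complex:
  assumes [measurable]: "f \<in> borel_measurable borel"
  shows "(\<integral>\<^sup>+z. f z \<partial>lborel) = (\<integral>\<^sup>+x. \<integral>\<^sup>+y. f (Complex x y) \<partial>lborel \<partial>lborel)"
    and "(\<integral>\<^sup>+z. f z \<partial>lborel) = (\<integral>\<^sup>+y. \<integral>\<^sup>+x. f (Complex x y) \<partial>lborel \<partial>lborel)"
proof -
  have "(\<integral>\<^sup>+z. f z \<partial>lborel) = (\<integral>\<^sup>+w. f (Complex (fst w) (snd w)) \<partial>(lborel \<Otimes>\<^sub>M lborel))"
    by (subst lborel_complex) (simp add: nn_integral_distr split_beta')
  also have "\<dots> = (\<integral>\<^sup>+x. \<integral>\<^sup>+y. f (Complex x y) \<partial>lborel \<partial>lborel)"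
    by (subst lborel.nn_integral_fst[symmetric]) auto
  finally show *: "(\<integral>\<^sup>+z. f z \<partial>lborel) = (\<integral>\<^sup>+x. \<integral>\<^sup>+y. f (Complex x y) \<partial>lborel \<partial>lborel)" .
  show "(\<integral>\<^sup>+z. f z \<partial>lborel) = (\<integral>\<^sup>+y. \<integral>\<^sup>+x. f (Complex x y) \<partial>lborel \<partial>lborel)"
    unfolding * by (rule lborel_pair.Fubini') simp
qed

text \<open>For fixed imaginary part the shear is a translation of the real part, so the inner
  Fubini integral does not change.\<close>

lemma lborel_complex_shear_Re: "distr lborel borel (\<lambda>z. z + of_real (a * Im z)) = (lborel :: complex measure)"
proof (rule measure_eqI)
  fix A :: "complex set"
  assume "A \<in> sets (distr lborel borel (\<lambda>z. z + of_real (a * Im z)))"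
  then have [measurable]: "A \<in> sets borel" by simp
  \<comment> \<open>The factor 1 brings the translation into the affine form of
    \<open>nn_integral_real_affine\<close>.\<close>
  have shift: "Complex x y + of_real (a * y) = Complex (a * y + 1 * x) y" for x y
    by (simp add: complex_eq_iff)
  have "emeasure (distr lborel borel (\<lambda>z. z + of_real (a * Im z))) A
      = (\<integral>\<^sup>+z. indicator A (z + of_real (a * Im z)) \<partial>lborel)"
    by (subst nn_integral_indicator[symmetric])
       (auto simp: nn_integral_distr simp del: nn_integral_indicator)
  also have "\<dots> = (\<integral>\<^sup>+y. \<integral>\<^sup>+x. indicator A (Complex (a * y + 1 * x) y) \<partial>lborel \<partial>lborel)"
    by (subst nn_integral_lborel_complex(2)) (simp_all add: shift del: of_real_mult)
  also have "\<dots> = (\<integral>\<^sup>+y. \<integral>\<^sup>+x. indicator A (Complex x y) \<partial>lborel \<partial>lborel)"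
    using nn_integral_real_affine[of "\<lambda>x. indicator A (Complex x y)" 1 "a * y" for y] by simp
  also have "\<dots> = emeasure lborel A"
    by (subst nn_integral_lborel_complex(2)[symmetric]) auto
  finally show "emeasure (distr lborel borel (\<lambda>z. z + of_real (a * Im z))) A = emeasure lborel A" .
qed simp

lemma lborel_complex_shear_Im:
  "distr lborel borel (\<lambda>z. z + \<i> * of_real (a * Re z)) = (lborel :: complex measure)"
proof (rule measure_eqI)
  fix A :: "complex set"
  assume "A \<in> sets (distr lborel borel (\<lambda>z. z + \<i> * of_real (a * Re z)))"
  then have [measurable]: "A \<in> sets borel" by simp
  have shift: "Complex x y + \<i> * of_real (a * x) = Complex x (a * x + 1 * y)" for x y
    by (simp add: complex_eq_iff)
  have "emeasure (distr lborel borel (\<lambda>z. z + \<i> * of_real (a * Re z))) A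
      = (\<integral>\<^sup>+z. indicator A (z + \<i> * of_real (a * Re z)) \<partial>lborel)"
    by (subst nn_integral_indicator[symmetric])
       (auto simp: nn_integral_distr simp del: nn_integral_indicator)
  also have "\<dots> = (\<integral>\<^sup>+x. \<integral>\<^sup>+y. indicator A (Complex x (a * x + 1 * y)) \<partial>lborel \<partial>lborel)"
    by (subst nn_integral_lborel_complex(1)) (simp_all add: shift del: of_real_mult)
  also have "\<dots> = (\<integral>\<^sup>+x. \<integral>\<^sup>+y. indicator A (Complex x y) \<partial>lborel \<partial>lborel)"
    using nn_integral_real_affine[of "\<lambda>y. indicator A (Complex x y)" 1 "a * x" for x] by simp
  also have "\<dots> = emeasure lborel A"
    by (subst nn_integral_lborel_complex(1)[symmetric]) auto
  finally show "emeasure (distr lborel borel (\<lambda>z. z + \<i> * of_real (a * Re z))) A = emeasure lborel A" .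
qed simp

text \<open>A rotation other than \<open>-1\<close> is a product of three shears.\<close>
lemma lborel_complex_rotation:
  fixes \<zeta> :: complex
  assumes "norm \<zeta> = 1" "\<zeta> \<noteq> -1"
  shows "distr lborel borel ((*) \<zeta>) = lborel"
proof -
  \<comment> \<open>Writing \<zeta> as \<open>cis t\<close>, \<open>a\<close> is
    \<open>- tan (t / 2)\<close>; this is the slope for which the shears \<open>T\<close>,
    \<open>S\<close>, \<open>T\<close> compose to the rotation. It is finite exactly because \<zeta>
    is not -1.\<close>
  define u v a where "u = Re \<zeta>" and "v = Im \<zeta>" and "a = - v / (1 + u)"
  define T S where "T = (\<lambda>z. z + of_real (a * Im z))" and "S = (\<lambda>z. z + \<i> * of_real (v * Re z))"
  have uv: "u\<^sup>2 + v\<^sup>2 = 1"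
    using assms(1) unfolding u_def v_def by (metis cmod_power2 one_power2)
  have u: "1 + u \<noteq> 0"
  proof
    assume "1 + u = 0"
    then have "u = -1" by simp
    moreover from this uv have "v = 0" by simp
    ultimately show False
      using assms(2) by (auto simp: u_def v_def complex_eq_iff)
  qed
  have a1: "1 + a * v = u"
  proof -
    have "v\<^sup>2 = (1 - u) * (1 + u)" using uv by (simp add: power2_eq_square algebra_simps)
    then have "a * v = - (1 - u)"
      using u by (simp add: a_def power2_eq_square field_simps)
    then show ?thesis by simp
  qed
  have a2: "a * (1 + u) = - v"
    using u by (simp add: a_def)
  have "T (S (T z)) = \<zeta> * z" for z
  proof -
    have Im2: "Im (S (T z)) = v * Re z + u * Im z"
      by (simp add: T_def S_def a1[symmetric] algebra_simps)
    have "Re z + a * Im z + a * (v * Re z + u * Im z) = (1 + a * v) * Re z + a * (1 + u) * Im z"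
      by (simp add: algebra_simps)
    also have "\<dots> = u * Re z - v * Im z"
      by (simp add: a1 a2)
    finally have "Re (T (S (T z))) = u * Re z - v * Im z"
      using Im2 by (simp add: T_def S_def)
    moreover have "Im (T (S (T z))) = v * Re z + u * Im z"
      using Im2 by (simp add: T_def)
    ultimately show ?thesis
      by (simp add: complex_eq_iff u_def v_def)
  qed
  then have "(*) \<zeta> = T \<circ> (S \<circ> T)" by (simp add: fun_eq_iff)
  moreover have [measurable]: "T \<in> borel_measurable borel" "S \<in> borel_measurable borel"
    by (simp_all add: T_def S_def)
  have dT: "distr lborel borel T = lborel" and dS: "distr lborel borel S = lborel"
    unfolding T_def S_def by (rule lborel_complex_shear_Re lborel_complex_shear_Im)+
  have "distr lborel borel (T \<circ> (S \<circ> T)) = distr (distr (distr lborel borel T) borel S) borel T"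
    by (simp add: distr_distr comp_assoc)
  ultimately show ?thesis
    by (simp add: dT dS)
qed

section \<open>The area mean value property of holomorphic functions\<close>

text \<open>Rotation about \<open>z\<close> by \<open>pi / (2 n)\<close> multiplies the integrand by \<open>\<i>\<close>.\<close>
lemma set_integral_cball_power:
  assumes "n > 0"
  shows "(LINT w:cball z r|lborel. (w - z) ^ n) = (0 :: complex)"
proof -
  define \<zeta> where "\<zeta> = cis (pi / (2 * real n))"
  have \<zeta>n: "\<zeta> ^ n = \<i>"
    unfolding \<zeta>_def Complex.DeMoivre using assms by simp
  have "norm \<zeta> = 1" by (simp add: \<zeta>_def)
  have "\<zeta> \<noteq> -1"
  proof
    assume "\<zeta> = -1"
    \<comment> \<open>\<open>(-1) ^ n\<close> squares to 1, whereas \<i> squares to -1.\<close>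
    then have "(\<zeta> ^ n)\<^sup>2 = 1" by (simp flip: power_mult power_mult_distrib)
    then show False by (simp add: \<zeta>n)
  qed
  define J where "J = (LINT w:cball 0 r|lborel. w ^ n :: complex)"
  have "(LINT w:cball z r|lborel. (w - z) ^ n) = J"
  proof -
    have [measurable]: "(\<lambda>w. indicator (cball z r) w *\<^sub>R (w - z) ^ n) \<in> borel_measurable borel"
      by (intro borel_measurable_scaleR borel_measurable_indicator borel_measurable_continuous_onI
          continuous_intros) auto
    have "J = (\<integral>w. indicator (cball z r) (z + w) *\<^sub>R ((z + w) - z) ^ n \<partial>lborel)"
      unfolding J_def set_lebesgue_integral_def
      by (intro Bochner_Integration.integral_cong) (auto simp: indicator_def dist_norm)
    also have "\<dots> = (\<integral>w. indicator (cball z r) w *\<^sub>R (w - z) ^ n \<partial>distr lborel borel ((+) z))"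
      by (subst integral_distr) auto
    finally show ?thesis
      by (simp add: lborel_distr_plus set_lebesgue_integral_def)
  qed
  moreover have "J = \<zeta> ^ n * J"
  proof -
    have [measurable]: "(\<lambda>w :: complex. indicator (cball 0 r) w *\<^sub>R w ^ n) \<in> borel_measurable borel"
      by (intro borel_measurable_scaleR borel_measurable_indicator borel_measurable_continuous_onI
          continuous_intros) auto
    have "J = (\<integral>w. indicator (cball 0 r) w *\<^sub>R w ^ n \<partial>distr lborel borel ((*) \<zeta>))"
      by (simp add: lborel_complex_rotation \<open>norm \<zeta> = 1\<close> \<open>\<zeta> \<noteq> -1\<close> J_def set_lebesgue_integral_def)
    also have "\<dots> = (\<integral>w. indicator (cball 0 r) (\<zeta> * w) *\<^sub>R (\<zeta> * w) ^ n \<partial>lborel)"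
      by (rule integral_distr) auto
    also have "\<dots> = (\<integral>w. \<zeta> ^ n * (indicator (cball 0 r) w *\<^sub>R w ^ n) \<partial>lborel)"
      using \<open>norm \<zeta> = 1\<close>
      by (intro Bochner_Integration.integral_cong)
         (auto simp: indicator_def norm_mult power_mult_distrib)
    finally show ?thesis
      by (simp only: J_def set_lebesgue_integral_def integral_mult_right_zero)
  qed
  then have "(1 - \<i>) * J = 0" by (simp add: \<zeta>n algebra_simps)
  then have "J = 0" by (simp add: complex_eq_iff)
  ultimately show ?thesis by simp
qed

lemma measure_lborel_cball_complex:
  assumes "r \<ge> 0"
  shows "measure lborel (cball (z :: complex) r) = pi * r\<^sup>2"
  using content_cball[OF assms, of z] by (simp add: unit_ball_vol_2 algebra_simps)

text \<open>Integrate the Taylor series at \<open>z\<close> term by term: every power of positive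
  degree has integral zero over the disc, and only the constant term is left.\<close>

lemma area_mean_value_holomorphic:
  assumes "h holomorphic_on ball z R" "0 < r" "r < R"
  shows "(LINT w:cball z r|lborel. h w) = of_real (pi * r\<^sup>2) * h z"
proof -
  define a where "a n = (deriv ^^ n) h z / fact n" for n
  have h: "(\<lambda>n. a n * (w - z) ^ n) sums h w" if "w \<in> ball z R" for w
    using holomorphic_power_series[OF assms(1) that] by (simp add: a_def)
  \<comment> \<open>Convergence at a radius beyond \<open>r\<close> gives absolute convergence at
    \<open>r\<close>, and this dominates the terms on the whole closed disc.\<close>
  obtain r' where r': "r < r'" "r' < R" using assms dense by blast
  have "summable (\<lambda>n. a n * of_real r' ^ n)"
    using h[of "z + of_real r'"] r' assms by (simp add: sums_iff dist_norm)
  then have summ: "summable (\<lambda>n. norm (a n) * r ^ n)"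
    using powser_insidea[of a "of_real r'" "of_real r"] r' assms
    by (simp add: norm_mult norm_power)
  define f where "f n w = indicator (cball z r) w *\<^sub>R (a n * (w - z) ^ n)" for n w
  have int: "integrable lborel (f n)" for n
    unfolding f_def by (rule borel_integrable_compact) (auto intro!: continuous_intros)
  have le: "norm (f n w) \<le> norm (a n) * r ^ n * indicator (cball z r) w" for n w
    by (auto simp: f_def indicator_def norm_mult norm_power dist_norm norm_minus_commute
        intro!: mult_left_mono power_mono)
  have le0: "norm (f n w) \<le> norm (a n) * r ^ n" for n w
    by (rule order_trans[OF le]) (use assms in \<open>simp add: indicator_def\<close>)
  have s1: "summable (\<lambda>n. norm (f n w))" for w
    by (rule summable_comparison_test[OF _ summ]) (use le0 in auto)
  have "(\<integral>w. norm (f n w) \<partial>lborel) \<le> norm (a n) * r ^ n * (pi * r\<^sup>2)" for n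
  proof -
    have "(\<integral>w. norm (f n w) \<partial>lborel) \<le> (\<integral>w. norm (a n) * r ^ n * indicator (cball z r) w \<partial>lborel)"
      by (rule integral_mono)
         (use int le in \<open>auto intro!: integrable_real_indicator simp: emeasure_lborel_cball_finite[unfolded infinity_ennreal_def]\<close>)
    then show ?thesis using assms
      by (simp add: measure_lborel_cball_complex)
  qed
  then have s2: "summable (\<lambda>n. \<integral>w. norm (f n w) \<partial>lborel)"
    by (intro summable_comparison_test[OF _ summable_mult2[OF summ, of "pi * r\<^sup>2"]]) auto
  have "(\<lambda>n. \<integral>w. f n w \<partial>lborel) sums (\<integral>w. (\<Sum>n. f n w) \<partial>lborel)"
    by (rule sums_integral) (use int s1 s2 in auto)
  moreover have "(\<Sum>n. f n w) = indicator (cball z r) w *\<^sub>R h w" for w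
  proof (cases "w \<in> cball z r")
    case True
    then show ?thesis
      using h[of w] assms by (simp add: f_def sums_iff)
  qed (simp add: f_def)
  moreover have "(\<integral>w. f n w \<partial>lborel) = (if n = 0 then of_real (pi * r\<^sup>2) * h z else 0)" for n
  proof -
    have "(\<integral>w. f n w \<partial>lborel) = a n * (LINT w:cball z r|lborel. (w - z) ^ n)"
      unfolding f_def set_lebesgue_integral_def by (simp flip: integral_mult_right_zero)
    then show ?thesis
      using assms set_integral_cball_power[of n z r]
      by (auto simp: a_def set_lebesgue_integral_def measure_lborel_cball_complex scaleR_conv_of_real)
  qed
  ultimately have "(\<lambda>n. if n = 0 then of_real (pi * r\<^sup>2) * h z else 0) sums
      (LINT w:cball z r|lborel. h w)"
    by (simp add: set_lebesgue_integral_def)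
  moreover have "(\<lambda>n. if n = 0 then of_real (pi * r\<^sup>2) * h z else 0) sums (of_real (pi * r\<^sup>2) * h z)"
    using sums_single[of 0 "\<lambda>_. of_real (pi * r\<^sup>2) * h z"] by simp
  ultimately show ?thesis
    using sums_unique2 by blast
qed

section \<open>Upper bounds for arc length and arc length integrals\<close>

text \<open>If the increments of \<open>V\<close> dominate the chords of \<gamma>, the length of
  every inscribed polygon is bounded by a telescoping sum of increments.\<close>

lemma arc_length_le:
  assumes le: "\<And>s t. a \<le> s \<Longrightarrow> s \<le> t \<Longrightarrow> t \<le> b \<Longrightarrow> dist (\<gamma> s) (\<gamma> t) \<le> V t - V s"
  shows "arc_length \<gamma> a b \<le> ennreal (V b - V a)"
  unfolding arc_length_def
proof (rule SUP_least, clarify)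
  fix m :: nat and t :: "nat \<Rightarrow> real"
  assume a: "a = t 0" and b: "b = t m" and mono: "\<forall>i<m. t i \<le> t (Suc i)"
  have t_mono: "t i \<le> t j" if "i \<le> j" "j \<le> m" for i j
    using that
  proof (induction rule: dec_induct)
    case (step k)
    then have "t i \<le> t k" by simp
    also have "t k \<le> t (Suc k)" using mono step by simp
    finally show ?case .
  qed simp
  have "(\<Sum>i<m. ennreal (dist (\<gamma> (t i)) (\<gamma> (t (Suc i))))) = ennreal (\<Sum>i<m. dist (\<gamma> (t i)) (\<gamma> (t (Suc i))))"
    by (rule sum_ennreal) simp
  also have "\<dots> \<le> ennreal (\<Sum>i<m. V (t (Suc i)) - V (t i))"
    by (intro ennreal_leI sum_mono le) (auto simp: a b intro!: t_mono)
  also have "\<dots> = ennreal (V (t m) - V (t 0))"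
    by (simp add: sum_lessThan_telescope[of "\<lambda>i. V (t i)"])
  finally show "(\<Sum>i<m. ennreal (dist (\<gamma> (t i)) (\<gamma> (t (Suc i))))) \<le> ennreal (V (t m) - V (t 0))" .
qed

lemma arc_length_integral_le:
  assumes "arc_length \<gamma> 0 1 \<le> ennreal L" and F: "\<And>t. t \<in> {0..1} \<Longrightarrow> F (\<gamma> t) \<le> B"
  shows "arc_length_integral \<gamma> F \<le> B * ennreal L"
proof -
  define s where "s = (\<lambda>t. enn2real (arc_length \<gamma> 0 (max 0 (min 1 t))))"
  have fin: "arc_length \<gamma> 0 1 < \<infinity>"
    using assms(1) by (metis ennreal_less_top infinity_ennreal_def le_less_trans)
  have "emeasure (interval_measure s) {0..1} \<le> emeasure (interval_measure s) {-1<..1}"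
    by (intro emeasure_mono) auto
  also have "\<dots> \<le> ennreal (s 1 - s (-1))"
    by (rule emeasure_interval_measure_Ioc_le) simp
  also have "\<dots> \<le> ennreal (s 1)"
    by (intro ennreal_leI) (simp add: s_def)
  also have "\<dots> \<le> ennreal L"
    using assms(1) fin by (simp add: s_def)
  finally have em: "emeasure (interval_measure s) {0..1} \<le> ennreal L" .
  have "arc_length_integral \<gamma> F = (\<integral>\<^sup>+t\<in>{0..1}. F (\<gamma> t) \<partial>interval_measure s)"
    using fin by (simp add: arc_length_integral_def s_def)
  also have "\<dots> \<le> (\<integral>\<^sup>+t. B * indicator {0..1} t \<partial>interval_measure s)"
    by (intro nn_integral_mono) (auto simp: indicator_def F)
  also have "\<dots> = B * emeasure (interval_measure s) {0..1}"
    by (simp add: nn_integral_cmult_indicator)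
  also have "\<dots> \<le> B * ennreal L"
    by (intro mult_left_mono em) simp
  finally show ?thesis .
qed

section \<open>Radial description of the frontier of a convex set\<close>

text \<open>On a segment from an interior point to a point of the closure, everything strictly
  between is interior. Hence the nearer of two frontier points on one ray would be interior.\<close>

lemma convex_frontier_ray_unique:
  fixes S :: "'a::euclidean_space set"
  assumes "convex S" "c \<in> interior S" "c + a *\<^sub>R u \<in> frontier S" "c + b *\<^sub>R u \<in> frontier S" "0 < a" "0 < b"
  shows "a = b"
proof (rule ccontr)
  have less: False if "c + a *\<^sub>R u \<in> frontier S" "c + b *\<^sub>R u \<in> frontier S" "0 < a" "a < b" for a b
  proof -
    have "u \<noteq> 0"
      using that assms(2) by (auto simp: frontier_def)
    have "c + a *\<^sub>R u = (1 - a / b) *\<^sub>R c + (a / b) *\<^sub>R (c + b *\<^sub>R u)"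
      using that by (simp add: algebra_simps)
    then have "c + a *\<^sub>R u \<in> open_segment c (c + b *\<^sub>R u)"
      using that \<open>u \<noteq> 0\<close> unfolding in_segment by (intro conjI exI[of _ "a / b"]) auto
    then show False
      using in_interior_closure_convex_segment[OF assms(1,2), of "c + b *\<^sub>R u"] that
      by (auto simp: frontier_def)
  qed
  assume "a \<noteq> b"
  then show False
    using less[of a b] less[of b a] assms by force
qed

text \<open>This is subadditivity of the Minkowski gauge of \<open>S\<close> about \<open>c\<close>:
  the gauge of \<open>v\<close> is \<open>1 / b\<close>, that of \<open>u\<close> is at most
  \<open>1 / a\<close>, and that of \<open>v - u\<close> is at most \<open>norm (v - u) / r\<close>
  because of the ball.\<close>

lemma convex_frontier_radial_inverse_le:
  fixes S :: "'a::euclidean_space set"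
  assumes S: "convex S" and ball: "cball c r \<subseteq> closure S" and c: "c \<in> interior S" and "0 < r"
    and x: "c + a *\<^sub>R u \<in> closure S" and y: "c + b *\<^sub>R v \<in> frontier S"
    and ab: "0 < a" "0 < b"
  shows "1 / b \<le> 1 / a + norm (v - u) / r"
proof (rule ccontr)
  assume neg: "\<not> ?thesis"
  \<comment> \<open>If the bound fails, \<open>1 / l\<close> exceeds \<open>b\<close>. The point at
    parameter \<open>1 / l\<close> on the ray along \<open>v\<close> is shown to lie in the closure,
    although it is beyond the frontier point.\<close>
  define l where "l = 1 / a + norm (v - u) / r"
  have l: "0 < l" "l * b < 1"
    using neg ab \<open>0 < r\<close> by (auto simp: l_def field_simps intro!: add_pos_nonneg)
  have "c + (1 / l) *\<^sub>R v \<in> closure S"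
  proof -
    \<comment> \<open>The point of the ball at distance \<open>r\<close> from \<open>c\<close> in
      the direction \<open>v - u\<close>. The point sought is a convex combination of
      \<open>w\<close> and \<open>c + a *\<^sub>R u\<close>.\<close>
    define w where "w = (if v = u then c else c + (r / norm (v - u)) *\<^sub>R (v - u))"
    have "w \<in> closure S"
      using ball \<open>0 < r\<close> by (auto simp: w_def dist_norm subset_iff)
    have ww: "(norm (v - u) / r) *\<^sub>R (w - c) = v - u"
      using \<open>0 < r\<close> by (simp add: w_def)
    have "(1 / a / l) *\<^sub>R (c + a *\<^sub>R u) + (norm (v - u) / r / l) *\<^sub>R w
        = (1 / l) *\<^sub>R ((1 / a + norm (v - u) / r) *\<^sub>R c + u + (norm (v - u) / r) *\<^sub>R (w - c))"
      using ab by (simp add: algebra_simps divide_inverse)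
    also have "\<dots> = c + (1 / l) *\<^sub>R v"
      unfolding ww l_def[symmetric] using l by (simp add: algebra_simps)
    finally have "(1 / a / l) *\<^sub>R (c + a *\<^sub>R u) + (norm (v - u) / r / l) *\<^sub>R w = c + (1 / l) *\<^sub>R v" .
    moreover have "1 / a / l + norm (v - u) / r / l = l / l"
      unfolding l_def by (rule add_divide_distrib[symmetric])
    then have "1 / a / l + norm (v - u) / r / l = 1"
      using l by simp
    ultimately show ?thesis
      using convexD[OF convex_closure[OF S] x \<open>w \<in> closure S\<close>, of "1 / a / l" "norm (v - u) / r / l"]
        l ab \<open>0 < r\<close> by simp
  qed
  moreover have "v \<noteq> 0"
    using y c by (auto simp: frontier_def)
  moreover have "c + b *\<^sub>R v = (1 - l * b) *\<^sub>R c + (l * b) *\<^sub>R (c + (1 / l) *\<^sub>R v)"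
    using l by (simp add: algebra_simps)
  then have "c + b *\<^sub>R v \<in> open_segment c (c + (1 / l) *\<^sub>R v)"
    using l ab \<open>v \<noteq> 0\<close> unfolding in_segment by (intro conjI exI[of _ "l * b"]) auto
  ultimately show False
    using in_interior_closure_convex_segment[OF S c] y by (auto simp: frontier_def)
qed

text \<open>Inverse radii are Lipschitz in the direction with constant \<open>1 / r\<close>, and
  radii are at most \<open>D\<close>, so radii are Lipschitz with constant
  \<open>D\<^sup>2 / r\<close>. Changing the direction at radius \<open>b\<close> costs the further
  term \<open>D\<close>.\<close>

lemma convex_frontier_radial_lipschitz:
  fixes S :: "'a::euclidean_space set"
  assumes S: "convex S" and ball: "cball c r \<subseteq> closure S" and c: "c \<in> interior S" and "0 < r"
    and D: "closure S \<subseteq> cball c D"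
    and x: "c + a *\<^sub>R u \<in> frontier S" and y: "c + b *\<^sub>R v \<in> frontier S"
    and ab: "0 < a" "0 < b" and uv: "norm u = 1" "norm v = 1"
  shows "dist (c + a *\<^sub>R u) (c + b *\<^sub>R v) \<le> (D\<^sup>2 / r + D) * norm (u - v)"
proof -
  have aD: "a \<le> D" and bD: "b \<le> D"
    using x y D ab uv by (force simp: frontier_def dist_norm)+
  \<comment> \<open>The one-sided estimate is used twice, with the two points exchanged.\<close>
  have "\<bar>1 / a - 1 / b\<bar> \<le> norm (u - v) / r"
    using convex_frontier_radial_inverse_le[OF S ball c \<open>0 < r\<close>, of a u b v]
      convex_frontier_radial_inverse_le[OF S ball c \<open>0 < r\<close>, of b v a u] x y ab
    by (auto simp: frontier_def norm_minus_commute abs_le_iff)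
  moreover have "\<bar>a - b\<bar> = a * b * \<bar>1 / a - 1 / b\<bar>"
  proof -
    have "a - b = a * b * (1 / b - 1 / a)" using ab by (simp add: field_simps)
    then show ?thesis using ab by (simp add: abs_mult abs_minus_commute)
  qed
  ultimately have "\<bar>a - b\<bar> \<le> a * b * (norm (u - v) / r)"
    using ab by (simp only: mult_left_mono zero_le_mult_iff less_imp_le simp_thms)
  also have "\<dots> \<le> D * D * (norm (u - v) / r)"
    using ab aD bD \<open>0 < r\<close> by (intro mult_right_mono mult_mono) auto
  finally have 1: "\<bar>a - b\<bar> \<le> D\<^sup>2 / r * norm (u - v)"
    by (simp add: power2_eq_square)
  have "c + a *\<^sub>R u - (c + b *\<^sub>R v) = (a - b) *\<^sub>R u + b *\<^sub>R (u - v)"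
    by (simp add: algebra_simps)
  then have "dist (c + a *\<^sub>R u) (c + b *\<^sub>R v) \<le> \<bar>a - b\<bar> + b * norm (u - v)"
    using norm_triangle_ineq[of "(a - b) *\<^sub>R u" "b *\<^sub>R (u - v)"] ab uv by (simp add: dist_norm)
  also have "\<dots> \<le> D\<^sup>2 / r * norm (u - v) + D * norm (u - v)"
    using 1 bD by (intro add_mono mult_right_mono) auto
  finally show ?thesis
    by (simp add: algebra_simps)
qed

section \<open>Length of closed convex curves\<close>

lemma norm_cis_diff_le: "norm (cis a - cis b) \<le> \<bar>a - b\<bar>"
proof -
  have "cis a - cis b = cis b * (cis (a - b) - 1)"
    by (simp add: cis_mult algebra_simps)
  then have "norm (cis a - cis b) = norm (cis (a - b) - 1)"
    by (simp add: norm_mult)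
  also have "\<dots> = dist (exp (\<i> * of_real (a - b))) 1"
    by (simp add: cis_conv_exp dist_norm)
  also have "\<dots> = 2 * \<bar>sin ((a - b) / 2)\<bar>"
    using dist_exp_i_1[of "a - b"] by (simp add: dist_norm)
  also have "\<dots> \<le> \<bar>a - b\<bar>"
    using abs_sin_x_le_abs_x[of "(a - b) / 2"] by simp
  finally show ?thesis .
qed

text \<open>The polar angle about \<open>c\<close> serves as the dominating function of
  \<open>arc_length_le\<close>, up to a constant factor: chords are controlled by angle differences,
  and the total variation of the angle is at most \<open>2 * pi\<close>.\<close>

lemma arc_length_convex_frontier_le:
  assumes \<gamma>: "simple_path \<gamma>" "pathfinish \<gamma> = pathstart \<gamma>" "path_image \<gamma> = frontier S"
    and S: "convex S" and ball: "cball c r \<subseteq> closure S" and c: "c \<in> interior S" and "0 < r"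
    and D: "closure S \<subseteq> cball c D" "0 \<le> D"
  shows "arc_length \<gamma> 0 1 \<le> ennreal ((D\<^sup>2 / r + D) * (2 * pi))"
proof -
  have fr: "\<gamma> t \<in> frontier S" if "t \<in> {0..1}" for t
    using that \<gamma>(3) by (auto simp: path_image_def)
  have "continuous_on {0..1} (\<lambda>t. \<gamma> t - c)"
    using \<gamma>(1) by (auto simp: simple_path_def path_def intro!: continuous_intros)
  moreover have "\<gamma> t - c \<noteq> 0" if "t \<in> {0..1}" for t
    using fr[OF that] c by (auto simp: frontier_def)
  \<comment> \<open>A continuous logarithm exists since the parameter interval is contractible; its
    imaginary part is a continuous choice of the angle.\<close>
  ultimately obtain g where g: "continuous_on {0..1} g" "\<And>t. t \<in> {0..1} \<Longrightarrow> \<gamma> t - c = exp (g t)"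
    using continuous_logarithm_on_contractible[of "{0..1}" "\<lambda>t. \<gamma> t - c"] convex_imp_contractible
    by (metis convex_real_interval(5))
  define \<theta> where "\<theta> t = Im (g t)" for t
  have cont: "continuous_on {0..1} \<theta>"
    unfolding \<theta>_def by (intro continuous_intros g)
  have polar: "\<gamma> t = c + exp (Re (g t)) *\<^sub>R cis (\<theta> t)" if "t \<in> {0..1}" for t
    using g(2)[OF that] by (simp add: \<theta>_def exp_eq_polar scaleR_conv_of_real algebra_simps)
  \<comment> \<open>Points in the same direction lie on one ray and hence coincide; a simple path
    takes a value twice only at its two endpoints.\<close>
  have ray: "s = t \<or> {s, t} = {0, 1}" if "s \<in> {0..1}" "t \<in> {0..1}" "cis (\<theta> s) = cis (\<theta> t)" for s t
  proof -
    have "exp (Re (g s)) = exp (Re (g t))"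
      by (rule convex_frontier_ray_unique[OF S c, of _ "cis (\<theta> t)"])
         (use fr[OF that(1)] fr[OF that(2)] polar that in auto)
    then have "\<gamma> s = \<gamma> t"
      using polar that by simp
    then show ?thesis
      using \<gamma>(1) that unfolding simple_path_def loop_free_def by blast
  qed
  \<comment> \<open>The parameter 1 is left out so that the exceptional pair 0, 1 of
    \<open>ray\<close> cannot occur.\<close>
  have "inj_on \<theta> {0..<1}"
    by (rule inj_onI) (use ray in force)
  moreover have "continuous_on {0..<1} \<theta>" "is_interval {0..<1::real}"
    using cont by (auto intro: continuous_on_subset simp: is_interval_co)
  ultimately have "strict_mono_on {0..<1} \<theta> \<or> strict_antimono_on {0..<1} \<theta>"
    using injective_eq_monotone_map by blast
  \<comment> \<open>The sign \<sigma> records the orientation; multiplying by it makes the angle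
    increasing in both cases.\<close>
  then obtain \<sigma> :: real where \<sigma>: "\<sigma> = 1 \<or> \<sigma> = -1"
    and sm: "\<And>s t. 0 \<le> s \<Longrightarrow> s < t \<Longrightarrow> t < 1 \<Longrightarrow> \<sigma> * \<theta> s < \<sigma> * \<theta> t"
  proof
    assume "strict_mono_on {0..<1} \<theta>"
    then show ?thesis
      by (intro that[of 1]) (auto simp: monotone_on_def)
  next
    assume "strict_antimono_on {0..<1} \<theta>"
    then show ?thesis
      by (intro that[of "-1"]) (auto simp: monotone_on_def)
  qed
  define \<phi> where "\<phi> t = \<sigma> * \<theta> t" for t
  have cont\<phi>: "continuous_on {0..1} \<phi>"
    unfolding \<phi>_def by (intro continuous_intros cont)
  have mono: "\<phi> s \<le> \<phi> t" if "0 \<le> s" "s \<le> t" "t \<le> 1" for s t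
  proof (cases "s = t \<or> t < 1")
    case True
    then show ?thesis
      using sm[of s t] that by (cases "s = t") (auto simp: \<phi>_def)
  next
    case False
    then have "t = 1" "s < 1" using that by auto
    have "\<phi> s \<le> \<phi> 1"
    \<comment> \<open>Strict monotonicity covers only parameters below 1; the inequality passes to
      the endpoint by continuity.\<close>
    proof (rule continuous_ge_on_closure[of "{s<..<1}" \<phi>])
      show "continuous_on (closure {s<..<1}) \<phi>"
        using \<open>s < 1\<close> that by (auto intro: continuous_on_subset[OF cont\<phi>])
    qed (use \<open>s < 1\<close> that sm in \<open>auto simp: \<phi>_def less_imp_le\<close>)
    then show ?thesis using \<open>t = 1\<close> by simp
  qed
  have full_turn: "\<phi> 1 - \<phi> 0 \<le> 2 * pi"
  proof (rule ccontr)
    assume "\<not> \<phi> 1 - \<phi> 0 \<le> 2 * pi"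
    \<comment> \<open>If the angle grew by more than a full turn, it would have grown by exactly
      \<open>2 * pi\<close> at some \<open>t\<close>. There the direction of the start recurs,
      forcing \<open>t = 0\<close> or \<open>t = 1\<close>, and both contradict the value of \<phi>
      at \<open>t\<close>.\<close>
    then obtain t where t: "0 \<le> t" "t \<le> 1" "\<phi> t = \<phi> 0 + 2 * pi"
      using IVT'[of \<phi> 0 "\<phi> 0 + 2 * pi" 1] cont\<phi> by auto
    have "\<theta> t = \<theta> 0 + 2 * pi \<or> \<theta> t = \<theta> 0 - 2 * pi"
      using t(3) \<sigma> by (auto simp: \<phi>_def)
    then have "cis (\<theta> t) = cis (\<theta> 0)"
      using cis_mult[of "\<theta> 0" "2 * pi"] cis_divide[of "\<theta> 0" "2 * pi"] by auto
    then have "t = 0 \<or> t = 1"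
      using ray[of t 0] t by (auto simp: doubleton_eq_iff)
    then show False
      using t \<open>\<not> \<phi> 1 - \<phi> 0 \<le> 2 * pi\<close> by auto
  qed
  define L where "L = D\<^sup>2 / r + D"
  have "0 \<le> L"
    using D \<open>0 < r\<close> by (simp add: L_def)
  have "arc_length \<gamma> 0 1 \<le> ennreal (L * \<phi> 1 - L * \<phi> 0)"
  proof (rule arc_length_le)
    fix s t :: real
    assume st: "0 \<le> s" "s \<le> t" "t \<le> 1"
    then have st': "s \<in> {0..1}" "t \<in> {0..1}" by auto
    have "dist (\<gamma> s) (\<gamma> t) \<le> L * norm (cis (\<theta> s) - cis (\<theta> t))"
      using convex_frontier_radial_lipschitz[OF S ball c \<open>0 < r\<close> D(1),
          of "exp (Re (g s))" "cis (\<theta> s)" "exp (Re (g t))" "cis (\<theta> t)"]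
        fr[OF st'(1)] fr[OF st'(2)]
      by (simp add: L_def flip: polar[OF st'(1)] polar[OF st'(2)])
    also have "\<dots> \<le> L * \<bar>\<theta> s - \<theta> t\<bar>"
      by (intro mult_left_mono norm_cis_diff_le \<open>0 \<le> L\<close>)
    also have "\<bar>\<theta> s - \<theta> t\<bar> = \<phi> t - \<phi> s"
      using mono[OF st] \<sigma> by (auto simp: \<phi>_def)
    finally show "dist (\<gamma> s) (\<gamma> t) \<le> L * \<phi> t - L * \<phi> s"
      by (simp add: algebra_simps)
  qed
  also have "\<dots> \<le> ennreal (L * (2 * pi))"
    using mult_left_mono[OF full_turn \<open>0 \<le> L\<close>] by (intro ennreal_leI) (simp add: algebra_simps)
  finally show ?thesis
    by (simp add: L_def)
qed

text \<open>The centre \<open>c\<close> and the radii \<open>r\<close> and \<open>D\<close> are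
  chosen from \<open>inside C\<close> alone, so a single bound serves all parametrizations of
  \<open>C\<close>. By the Jordan curve theorem \<open>C\<close> is the frontier of its
  inside.\<close>

lemma arc_length_convex_curve_bounded:
  assumes "simple_closed_param \<gamma>\<^sub>0 C" "convex (inside C)"
  shows "\<exists>L\<ge>0. \<forall>\<gamma>. simple_closed_param \<gamma> C \<longrightarrow> arc_length \<gamma> 0 1 \<le> ennreal L"
proof -
  have \<gamma>\<^sub>0: "simple_path \<gamma>\<^sub>0" "pathfinish \<gamma>\<^sub>0 = pathstart \<gamma>\<^sub>0" "path_image \<gamma>\<^sub>0 = C"
    using assms(1) by (simp_all add: simple_closed_param_def)
  have J: "inside C \<noteq> {}" "open (inside C)" "bounded (inside C)" "frontier (inside C) = C"
    using Jordan_inside_outside[OF \<gamma>\<^sub>0(1,2), unfolded \<gamma>\<^sub>0(3)] by blast+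
  obtain c where c: "c \<in> inside C" using J(1) by blast
  obtain r where r: "0 < r" "cball c r \<subseteq> inside C"
    using open_contains_cball_eq[OF J(2)] c by blast
  have "bounded (closure (inside C))"
    using J(3) by (rule bounded_closure)
  then obtain D where D: "closure (inside C) \<subseteq> cball c D"
    using bounded_any_center[of "closure (inside C)" c] by (auto simp: subset_iff)
  have sub: "inside C \<subseteq> closure (inside C)"
    by (rule closure_subset)
  have "c \<in> cball c D"
    using c D sub by blast
  then have "0 \<le> D" by simp
  have "arc_length \<gamma> 0 1 \<le> ennreal ((D\<^sup>2 / r + D) * (2 * pi))" if "simple_closed_param \<gamma> C" for \<gamma>
  proof (rule arc_length_convex_frontier_le[of _ "inside C" c])
    show "simple_path \<gamma>" "pathfinish \<gamma> = pathstart \<gamma>" "path_image \<gamma> = frontier (inside C)"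
      using that J(4) by (simp_all add: simple_closed_param_def)
    show "cball c r \<subseteq> closure (inside C)"
      using r(2) sub by blast
    show "c \<in> interior (inside C)"
      using c J(2) by (simp add: interior_open)
  qed (fact assms(2) r(1) D \<open>0 \<le> D\<close>)+
  moreover have "0 \<le> (D\<^sup>2 / r + D) * (2 * pi)"
    using r \<open>0 \<le> D\<close> by simp
  ultimately show ?thesis by blast
qed

section \<open>Subharmonicity of powers of the modulus of a harmonic function\<close>

text \<open>Conjugation commutes with integration, so the mean value property of \<open>h\<close>
  and of \<open>g\<close> carries over to the sum.\<close>

lemma area_mean_value_harmonic:
  assumes h: "h holomorphic_on ball z R" and g: "g holomorphic_on ball z R" and r: "0 < r" "r < R"
    and f: "\<And>w. w \<in> ball z R \<Longrightarrow> f w = h w + cnj (g w)"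
  shows "(LINT w:cball z r|lborel. f w) = of_real (pi * r\<^sup>2) * f z"
proof -
  have sub: "cball z r \<subseteq> ball z R" using r by auto
  have cont: "continuous_on (cball z r) h" "continuous_on (cball z r) g"
    by (rule continuous_on_subset[OF holomorphic_on_imp_continuous_on sub], rule h g)+
  have "(LINT w:cball z r|lborel. f w) = (LINT w:cball z r|lborel. h w + cnj (g w))"
    by (rule set_lebesgue_integral_cong) (use f sub in auto)
  also have "\<dots> = (LINT w:cball z r|lborel. h w) + (LINT w:cball z r|lborel. cnj (g w))"
    by (intro set_integral_add; unfold set_integrable_def; rule borel_integrable_compact)
       (auto intro: continuous_on_cnj cont)
  also have "(LINT w:cball z r|lborel. cnj (g w)) = cnj (LINT w:cball z r|lborel. g w)"
    using Bochner_Integration.integral_cnj[of lborel "\<lambda>w. indicator (cball z r) w *\<^sub>R g w"]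
    by (simp add: set_lebesgue_integral_def)
  finally have "(LINT w:cball z r|lborel. f w)
      = of_real (pi * r\<^sup>2) * h z + cnj (of_real (pi * r\<^sup>2) * g z)"
    by (simp only: area_mean_value_holomorphic[OF h r] area_mean_value_holomorphic[OF g r])
  also have "\<dots> = of_real (pi * r\<^sup>2) * f z"
    using f[of z] r by (simp add: distrib_left)
  finally show ?thesis .
qed

text \<open>Jensen's inequality for the average over the disc: a convex function lies above its
  tangent line at \<open>norm (f z)\<close>, and the tangent inequality is integrated over the
  disc.\<close>

lemma powr_submean_cball:
  fixes f :: "complex \<Rightarrow> 'a::real_normed_vector"
  assumes "1 < p" "0 \<le> r" and cont: "continuous_on (cball z r) f"
    and submean: "pi * r\<^sup>2 * norm (f z) \<le> (LINT w:cball z r|lborel. norm (f w))"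
  shows "pi * r\<^sup>2 * norm (f z) powr p \<le> (LINT w:cball z r|lborel. norm (f w) powr p)"
proof (cases "f z = 0")
  case True
  then show ?thesis
    using assms(1) by (simp add: set_lebesgue_integral_def)
next
  case False
  define s where "s = norm (f z)"
  have "s > 0" using False by (simp add: s_def)
  \<comment> \<open>the tangent line of \<open>x powr p\<close> at \<open>s\<close>\<close>
  have tangent: "p * s powr (p - 1) * x - (p - 1) * s powr p \<le> x powr p" if "x \<ge> 0" for x
  proof -
    \<comment> \<open>Young's inequality for the conjugate exponents \<open>p\<close> and
      \<open>p / (p - 1)\<close>, multiplied by \<open>p\<close>, is the tangent inequality.\<close>
    have "1 / p + 1 / (p / (p - 1)) = 1"
      using assms(1) by (simp add: diff_divide_distrib)
    then have "x * s powr (p - 1) \<le> x powr p / p + (s powr (p - 1)) powr (p / (p - 1)) / (p / (p - 1))"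
      using assms(1) that by (intro Youngs_inequality) auto
    also have "(s powr (p - 1)) powr (p / (p - 1)) = s powr p"
      using assms(1) by (simp add: powr_powr)
    finally have "p * (x * s powr (p - 1)) \<le> p * (x powr p / p + s powr p / (p / (p - 1)))"
      using assms(1) by (intro mult_left_mono) auto
    also have "\<dots> = x powr p + (p - 1) * s powr p"
      using assms(1) by (simp add: distrib_left)
    finally show ?thesis
      by (simp add: mult_ac)
  qed
  have int: "integrable lborel (\<lambda>w. indicator (cball z r) w *\<^sub>R u w)" if "continuous_on (cball z r) u"
    for u :: "complex \<Rightarrow> real"
    by (rule borel_integrable_compact) (use that in auto)
  have i1: "set_integrable lborel (cball z r) (\<lambda>w. norm (f w))"
    unfolding set_integrable_def by (intro int continuous_intros cont)
  have i2: "set_integrable lborel (cball z r) (\<lambda>w. norm (f w) powr p)"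
    unfolding set_integrable_def
    by (intro int continuous_on_powr' continuous_intros cont) (use assms(1) in auto)
  have i0: "set_integrable lborel (cball z r) (\<lambda>w. (p - 1) * s powr p)"
    unfolding set_integrable_def by (intro int continuous_intros)
  \<comment> \<open>The tangent line touches the graph at \<open>s\<close>. Its slope is
    nonnegative, so the submean hypothesis can then be inserted in the linear term.\<close>
  have "pi * r\<^sup>2 * s powr p = p * s powr (p - 1) * (pi * r\<^sup>2 * s) - pi * r\<^sup>2 * ((p - 1) * s powr p)"
  proof -
    have "s powr (p - 1) * s = s powr p"
      using powr_add[of s "p - 1" 1] \<open>s > 0\<close> by simp
    then show ?thesis by (simp add: algebra_simps)
  qed
  also have "\<dots> \<le> p * s powr (p - 1) * (LINT w:cball z r|lborel. norm (f w)) - pi * r\<^sup>2 * ((p - 1) * s powr p)"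
    using submean assms(1) by (intro diff_right_mono mult_left_mono) (auto simp: s_def)
  also have "pi * r\<^sup>2 * ((p - 1) * s powr p) = (LINT w:cball z r|lborel. (p - 1) * s powr p)"
    using assms(2) by (simp add: set_lebesgue_integral_def measure_lborel_cball_complex)
  also have "p * s powr (p - 1) * (LINT w:cball z r|lborel. norm (f w)) - \<dots>
      = (LINT w:cball z r|lborel. p * s powr (p - 1) * norm (f w) - (p - 1) * s powr p)"
    using i1 i0 by (simp only: set_integral_diff set_integral_mult_right set_integrable_mult_right)
  also have "\<dots> \<le> (LINT w:cball z r|lborel. norm (f w) powr p)"
    by (rule set_integral_mono) (use i0 i1 i2 tangent in auto)
  finally show ?thesis
    by (simp add: s_def)
qed

lemma powr_submean_harmonic:
  assumes p: "1 < p" and h: "h holomorphic_on ball z R" and g: "g holomorphic_on ball z R"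
    and r: "0 < r" "r < R" and f: "\<And>w. w \<in> ball z R \<Longrightarrow> f w = h w + cnj (g w)"
  shows "pi * r\<^sup>2 * norm (f z) powr p \<le> (LINT w:cball z r|lborel. norm (f w) powr p)"
proof (rule powr_submean_cball)
  have sub: "cball z r \<subseteq> ball z R" using r by auto
  have "continuous_on (ball z R) (\<lambda>w. h w + cnj (g w))"
    by (intro continuous_intros holomorphic_on_imp_continuous_on h g)
  then have "continuous_on (ball z R) f"
    by (rule continuous_on_eq) (simp add: f)
  then show "continuous_on (cball z r) f"
    using sub by (rule continuous_on_subset)
  have "pi * r\<^sup>2 * norm (f z) = norm (LINT w:cball z r|lborel. f w)"
    using area_mean_value_harmonic[OF h g r f] by (simp add: norm_mult norm_power)
  also have "\<dots> \<le> (LINT w:cball z r|lborel. norm (f w))"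
    unfolding set_lebesgue_integral_def
    using integral_norm_bound[of lborel "\<lambda>w. indicator (cball z r) w *\<^sub>R f w"] by simp
  finally show "pi * r\<^sup>2 * norm (f z) \<le> (LINT w:cball z r|lborel. norm (f w))" .
qed (use p r in auto)

section \<open>From point values to the weighted area integral\<close>

text \<open>On the disc of radius \<rho> about \<open>z\<close> the base of the weight lies between
  \<open>1 - R\<^sup>2\<close> and 1. So every exponent up to \<open>\<bar>\<alpha>\<bar>\<close>
  gives a weight of at least \<open>\<kappa>\<close>. The constant therefore does not contain
  \<beta>, which later makes the final constant independent of \<open>n\<close>.\<close>

lemma weighted_submean_disc:
  assumes p: "1 < p" and h: "h holomorphic_on unit_disc" and g: "g holomorphic_on unit_disc"
    and f: "\<And>w. w \<in> unit_disc \<Longrightarrow> f w = h w + cnj (g w)"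
    and \<rho>: "0 < \<rho>" "norm z + \<rho> \<le> R" "R < 1" and \<beta>: "\<beta> \<le> \<bar>\<alpha>\<bar>"
  shows "ennreal (norm (f z) powr p)
    \<le> ennreal ((1 - R\<^sup>2) powr (-\<bar>\<alpha>\<bar>) / \<rho>\<^sup>2) *
      (\<integral>\<^sup>+w\<in>unit_disc. ennreal (norm (f w) powr p * (1 - (norm w)\<^sup>2) powr \<beta>) \<partial>dA)"
    (is "_ \<le> _ * ?I")
proof -
  define \<kappa> where "\<kappa> = (1 - R\<^sup>2) powr \<bar>\<alpha>\<bar>"
  define J where "J = (LINT w:cball z \<rho>|lborel. norm (f w) powr p)"
  have sub: "cball z \<rho> \<subseteq> unit_disc"
  proof
    fix w assume "w \<in> cball z \<rho>"
    then show "w \<in> unit_disc"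
      using \<rho> norm_triangle_sub[of w z] by (simp add: dist_norm norm_minus_commute)
  qed
  have "0 < R" using \<rho> norm_ge_zero[of z] by linarith
  then have "0 < 1 - R\<^sup>2"
    using \<rho> by (simp add: power_less_one_iff abs_square_less_1)
  then have "\<kappa> > 0" by (simp add: \<kappa>_def)
  have weight: "\<kappa> \<le> (1 - (norm w)\<^sup>2) powr \<beta>" if "w \<in> cball z \<rho>" for w
  proof -
    have "norm w \<le> R"
      using that \<rho> norm_triangle_sub[of w z] by (simp add: dist_norm norm_minus_commute)
    then have w: "1 - R\<^sup>2 \<le> 1 - (norm w)\<^sup>2" by (simp add: power_mono)
    have "\<kappa> \<le> (1 - (norm w)\<^sup>2) powr \<bar>\<alpha>\<bar>"
      unfolding \<kappa>_def by (rule powr_mono2) (use w \<open>0 < 1 - R\<^sup>2\<close> in auto)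
    also have "\<dots> \<le> (1 - (norm w)\<^sup>2) powr \<beta>"
      by (rule powr_mono') (use \<beta> w \<open>0 < 1 - R\<^sup>2\<close> in auto)
    finally show ?thesis .
  qed
  \<comment> \<open>This open disc contains the closed disc of radius \<rho> and is the domain on
    which the mean value property is applied.\<close>
  have sub': "ball z (1 - norm z) \<subseteq> unit_disc"
  proof
    fix w assume "w \<in> ball z (1 - norm z)"
    then show "w \<in> unit_disc"
      using norm_triangle_sub[of w z] by (simp add: dist_norm norm_minus_commute)
  qed
  have fJ: "pi * \<rho>\<^sup>2 * norm (f z) powr p \<le> J"
    unfolding J_def
    by (rule powr_submean_harmonic[OF p, of h z "1 - norm z" g])
       (use holomorphic_on_subset[OF h sub'] holomorphic_on_subset[OF g sub'] f sub' \<rho> in auto)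
  have "continuous_on unit_disc (\<lambda>w. h w + cnj (g w))"
    by (intro continuous_intros holomorphic_on_imp_continuous_on h g)
  then have contf: "continuous_on unit_disc f"
    by (rule continuous_on_eq) (simp add: f)
  have c1: "continuous_on unit_disc (\<lambda>w. norm (f w) powr p)"
    by (rule continuous_on_powr') (use p in \<open>auto intro!: continuous_intros contf\<close>)
  have c2: "continuous_on unit_disc (\<lambda>w. (1 - (norm w)\<^sup>2) powr \<beta>)"
  proof (intro continuous_on_powr continuous_intros ballI)
    fix w :: complex
    assume "w \<in> unit_disc"
    then have "(norm w)\<^sup>2 < 1" by (simp add: abs_square_less_1)
    then show "1 - (norm w)\<^sup>2 \<noteq> 0" by simp
  qed
  have int: "integrable lborel (\<lambda>w. indicator (cball z \<rho>) w *\<^sub>R (norm (f w) powr p))"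
    by (intro borel_integrable_compact continuous_on_subset[OF c1 sub]) simp
  have "(\<integral>\<^sup>+w. ennreal (indicator (cball z \<rho>) w *\<^sub>R (norm (f w) powr p)) \<partial>lborel)
      = ennreal (\<integral>w. indicator (cball z \<rho>) w *\<^sub>R (norm (f w) powr p) \<partial>lborel)"
    by (rule nn_integral_eq_integral[OF int]) simp
  then have J: "ennreal J = (\<integral>\<^sup>+w. ennreal (indicator (cball z \<rho>) w * norm (f w) powr p) \<partial>lborel)"
    by (simp add: J_def set_lebesgue_integral_def)
  have meas: "(\<lambda>w. ennreal (indicator (cball z \<rho>) w * norm (f w) powr p)) \<in> borel_measurable lborel"
    using borel_measurable_integrable[OF int] by simp
  have "(\<lambda>w. indicator unit_disc w *\<^sub>R (norm (f w) powr p * (1 - (norm w)\<^sup>2) powr \<beta>)) \<in> borel_measurable borel"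
    by (intro borel_measurable_continuous_on_indicator continuous_on_mult c1 c2) simp
  then have meas2: "(\<lambda>w. ennreal (norm (f w) powr p * (1 - (norm w)\<^sup>2) powr \<beta>) * indicator unit_disc w)
      \<in> borel_measurable lborel"
    by (subst measurable_cong[where g = "\<lambda>w. ennreal (indicator unit_disc w *\<^sub>R
          (norm (f w) powr p * (1 - (norm w)\<^sup>2) powr \<beta>))"])
       (auto simp: indicator_def)
  \<comment> \<open>The factor \<open>1 / pi\<close> is the normalization of
    \<open>dA\<close>.\<close>
  have "ennreal (\<kappa> / pi * J) = ennreal (1 / pi) * (ennreal \<kappa> * ennreal J)"
    using \<open>\<kappa> > 0\<close> by (simp flip: ennreal_mult')
  also have "\<dots> = ennreal (1 / pi) *
      (\<integral>\<^sup>+w. ennreal \<kappa> * ennreal (indicator (cball z \<rho>) w * norm (f w) powr p) \<partial>lborel)"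
    by (simp only: J nn_integral_cmult[OF meas])
  also have "\<dots> \<le> ennreal (1 / pi) *
      (\<integral>\<^sup>+w\<in>unit_disc. ennreal (norm (f w) powr p * (1 - (norm w)\<^sup>2) powr \<beta>) \<partial>lborel)"
  proof (intro mult_left_mono nn_integral_mono)
    fix w
    show "ennreal \<kappa> * ennreal (indicator (cball z \<rho>) w * norm (f w) powr p)
      \<le> ennreal (norm (f w) powr p * (1 - (norm w)\<^sup>2) powr \<beta>) * indicator unit_disc w"
    proof (cases "w \<in> cball z \<rho>")
      case True
      then have "ennreal \<kappa> * ennreal (norm (f w) powr p)
          \<le> ennreal ((1 - (norm w)\<^sup>2) powr \<beta>) * ennreal (norm (f w) powr p)"
        by (intro mult_right_mono ennreal_leI weight) auto
      then show ?thesis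
        using True sub by (auto simp: ennreal_mult mult_ac)
    qed simp
  qed simp
  also have "\<dots> = ?I"
    unfolding dA_def by (rule nn_integral_scale_measure[symmetric])
       (use meas2 in auto)
  finally have I: "ennreal (\<kappa> / pi * J) \<le> ?I" .
  have "norm (f z) powr p = (1 - R\<^sup>2) powr (-\<bar>\<alpha>\<bar>) / \<rho>\<^sup>2 * (\<kappa> / pi * (pi * \<rho>\<^sup>2 * norm (f z) powr p))"
    using \<rho> \<open>0 < 1 - R\<^sup>2\<close> by (simp add: \<kappa>_def powr_minus field_simps)
  also have "\<dots> \<le> (1 - R\<^sup>2) powr (-\<bar>\<alpha>\<bar>) / \<rho>\<^sup>2 * (\<kappa> / pi * J)"
    using \<open>\<kappa> > 0\<close> by (intro mult_left_mono fJ) auto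
  finally have "ennreal (norm (f z) powr p) \<le> ennreal ((1 - R\<^sup>2) powr (-\<bar>\<alpha>\<bar>) / \<rho>\<^sup>2 * (\<kappa> / pi * J))"
    by (rule ennreal_leI)
  also have "\<dots> = ennreal ((1 - R\<^sup>2) powr (-\<bar>\<alpha>\<bar>) / \<rho>\<^sup>2) * ennreal (\<kappa> / pi * J)"
    by (rule ennreal_mult') simp
  also have "\<dots> \<le> ennreal ((1 - R\<^sup>2) powr (-\<bar>\<alpha>\<bar>) / \<rho>\<^sup>2) * ?I"
    by (intro mult_left_mono I) simp
  finally show ?thesis .
qed

section \<open>The integral along the curve\<close>

theorem corollary2p2:
  fixes p \<alpha> :: real and C :: "complex set"
  assumes "1 < p" and "convex_curve_in_disc C"
  shows "\<exists>K::real. K > 0 \<and>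
    (\<forall>n::nat. n \<ge> 1 \<longrightarrow> \<alpha> > real n * p - 1 \<longrightarrow>
      (\<forall>f \<in> Qh n p \<alpha>. \<forall>\<gamma>. simple_closed_param \<gamma> C \<longrightarrow>
        arc_length_integral \<gamma>
          (\<lambda>z. ennreal (norm (f z) powr p * (1 - (norm z)\<^sup>2) powr (\<alpha> + 1 - real n * p)))
        \<le> ennreal K *
          (\<integral>\<^sup>+z\<in>unit_disc.
             ennreal (norm (f z) powr p * (1 - (norm z)\<^sup>2) powr (\<alpha> - real n * p)) \<partial>dA)))"
proof -
  obtain \<gamma>\<^sub>0 where \<gamma>\<^sub>0: "simple_closed_param \<gamma>\<^sub>0 C" and C: "C \<subseteq> unit_disc" "convex (inside C)"
    using assms(2) by (auto simp: convex_curve_in_disc_def)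
  obtain L where L: "L \<ge> 0" "\<And>\<gamma>. simple_closed_param \<gamma> C \<Longrightarrow> arc_length \<gamma> 0 1 \<le> ennreal L"
    using arc_length_convex_curve_bounded[OF \<gamma>\<^sub>0 C(2)] by blast
  have "compact C" "C \<noteq> {}"
    using \<gamma>\<^sub>0 by (auto simp: simple_closed_param_def simple_path_def intro: compact_path_image)
  then obtain z\<^sub>0 where z\<^sub>0: "z\<^sub>0 \<in> C" "\<And>z. z \<in> C \<Longrightarrow> norm z \<le> norm z\<^sub>0"
    using continuous_attains_sup[of C norm] continuous_on_norm_id by blast
  \<comment> \<open>Half the distance from the outermost point of \<open>C\<close> to the unit
    circle: the closed disc of radius \<rho> about any point of \<open>C\<close> stays in the closed
    disc of radius \<open>R < 1\<close> about 0.\<close>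
  define \<rho> R where "\<rho> = (1 - norm z\<^sub>0) / 2" and "R = norm z\<^sub>0 + \<rho>"
  have \<rho>: "0 < \<rho>" "R < 1"
    using z\<^sub>0(1) C(1) by (auto simp: \<rho>_def R_def field_simps)
  define K where "K = (1 - R\<^sup>2) powr (-\<bar>\<alpha>\<bar>) / \<rho>\<^sup>2"
  have "K \<ge> 0" by (simp add: K_def)
  show ?thesis
  \<comment> \<open>The summand 1 ensures a positive constant, since \<open>L\<close> is only known
    to be nonnegative.\<close>
  proof (intro exI[of _ "K * L + 1"] conjI allI impI ballI)
    show "0 < K * L + 1"
      using \<open>K \<ge> 0\<close> L(1) by (intro add_nonneg_pos) auto
    fix n :: nat and f \<gamma>
    assume n: "n \<ge> 1" "\<alpha> > real n * p - 1" and f: "f \<in> Qh n p \<alpha>" and \<gamma>: "simple_closed_param \<gamma> C"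
    obtain h g where hg: "h holomorphic_on unit_disc" "g holomorphic_on unit_disc"
        "\<And>z. z \<in> unit_disc \<Longrightarrow> f z = h z + cnj (g z)"
      using f by (auto simp: Qh_def)
    define I where "I = (\<integral>\<^sup>+z\<in>unit_disc.
      ennreal (norm (f z) powr p * (1 - (norm z)\<^sup>2) powr (\<alpha> - real n * p)) \<partial>dA)"
    have "arc_length_integral \<gamma>
        (\<lambda>z. ennreal (norm (f z) powr p * (1 - (norm z)\<^sup>2) powr (\<alpha> + 1 - real n * p)))
      \<le> (ennreal K * I) * ennreal L"
    proof (rule arc_length_integral_le[OF L(2)[OF \<gamma>]])
      fix t :: real
      assume "t \<in> {0..1}"
      then have z: "\<gamma> t \<in> C"
        using \<gamma> by (auto simp: simple_closed_param_def path_image_def)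
      then have "norm (\<gamma> t) < 1"
        using C(1) by auto
      \<comment> \<open>The hypothesis on \<alpha> says that this exponent is positive, and the base
        is at most 1.\<close>
      then have "(1 - (norm (\<gamma> t))\<^sup>2) powr (\<alpha> + 1 - real n * p) \<le> 1"
        using n(2) by (intro powr_le1) (auto simp: power_le_one_iff abs_square_le_1)
      then have "ennreal (norm (f (\<gamma> t)) powr p * (1 - (norm (\<gamma> t))\<^sup>2) powr (\<alpha> + 1 - real n * p))
          \<le> ennreal (norm (f (\<gamma> t)) powr p)"
        by (intro ennreal_leI mult_left_le) auto
      \<comment> \<open>The exponent \<open>\<alpha> - real n * p\<close> takes the place of
        \<beta>; it is at most \<alpha>, hence at most \<open>\<bar>\<alpha>\<bar>\<close>.\<close>
      also have "\<dots> \<le> ennreal K * I"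
        unfolding K_def I_def
        by (rule weighted_submean_disc[OF assms(1) hg])
           (use \<rho> z\<^sub>0(2)[OF z] n assms(1) in \<open>auto simp: R_def intro: order_trans[OF _ abs_ge_self]\<close>)
      finally show "ennreal (norm (f (\<gamma> t)) powr p * (1 - (norm (\<gamma> t))\<^sup>2) powr (\<alpha> + 1 - real n * p))
          \<le> ennreal K * I" .
    qed
    also have "\<dots> = ennreal (K * L) * I"
      using \<open>K \<ge> 0\<close> L(1) by (simp add: ennreal_mult mult_ac)
    also have "\<dots> \<le> ennreal (K * L + 1) * I"
      by (intro mult_right_mono ennreal_leI) auto
    finally show "arc_length_integral \<gamma>
        (\<lambda>z. ennreal (norm (f z) powr p * (1 - (norm z)\<^sup>2) powr (\<alpha> + 1 - real n * p)))
      \<le> ennreal (K * L + 1) * (\<integral>\<^sup>+z\<in>unit_disc.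
          ennreal (norm (f z) powr p * (1 - (norm z)\<^sup>2) powr (\<alpha> - real n * p)) \<partial>dA)"
      unfolding I_def .
  qed
qed

end
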